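(* There exist absolute constants $c>0$ and $n_0\ge 1$ such that for all integers $n\ge n_0$ and $m\ge 1$ the following holds. Let $\mathcal{T}$ be any randomized algorithm that, given entry-query access to any nonzero positive semidefinite matrix $\mathbf{A}\in\mathbb{R}^{n\times n}$, outputs $m$ indices $i_1,\dots,i_m\in\{1,\dots,n\}$ sampled independently from the length-squared distribution $$\Pr[I=i]=\frac{\|\mathbf{A}_{*,i}\|_2^2}{\|\mathbf{A}\|_{\mathrm F}^2},\qquad i\in\{1,\dots,n\}.$$ Then there is a nonzero positive semidefinite input $\mathbf{A}\in\mathbb{R}^{n\times n}$ on which the expected number of entries of $\mathbf{A}$ read by $\mathcal{T}$ is at least $c\cdot\min\{mn,n^2\}$.
   Context: $\mathbf{A}_{*,i}$ is the $i$th column of $\mathbf{A}$ and $\|\cdot\|_{\mathrm F}$ is the Frobenius norm. A positive semidefinite matrix is a real symmetric matrix with $\mathbf{x}^\top\mathbf{A}\mathbf{x}\ge0$ for all $\mathbf{x}$. Access model: the algorithm learns about $\mathbf{A}$ only by adaptively querying individual entries $\mathbf{A}_{ij}$; it may use arbitrary internal randomness, and the expectation is over this randomness. The algorithm may depend on $n$ and $m$. *)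

theory Defs
  imports "HOL-Probability.Probability" "Jordan_Normal_Form.Matrix"
begin

unbundle no inner_syntax and no vec_syntax

definition positive_semidefinite :: "real mat \<Rightarrow> bool" where
  "positive_semidefinite A \<longleftrightarrow>
     square_mat A \<and> transpose_mat A = A \<and> (\<forall>x \<in> carrier_vec (dim_row A). x \<bullet> (A *\<^sub>v x) \<ge> 0)"

definition nonzero_psd :: "nat \<Rightarrow> real mat set" where
  "nonzero_psd n = {A \<in> carrier_mat n n. positive_semidefinite A \<and> A \<noteq> 0\<^sub>m n n}"

definition l2_norm :: "real vec \<Rightarrow> real" where
  "l2_norm v = sqrt (\<Sum>i<dim_vec v. (v $ i)\<^sup>2)"

definition frobenius_norm :: "real mat \<Rightarrow> real" where
  "frobenius_norm A = sqrt (\<Sum>i<dim_row A. \<Sum>j<dim_col A. (A $$ (i, j))\<^sup>2)"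

text \<open>Rows and columns are numbered from \<open>0\<close>. The function below is a probability mass
  function only if \<open>A\<close> is nonzero, cf. the lemma that follows; for the zero matrix the
  distribution is unspecified.\<close>

definition length_squared_pmf :: "real mat \<Rightarrow> nat pmf" where
  "length_squared_pmf A =
     embed_pmf (\<lambda>i. if i < dim_col A then (l2_norm (col A i))\<^sup>2 / (frobenius_norm A)\<^sup>2 else 0)"

lemma frobenius_norm_sq_eq_sum_cols:
  "(frobenius_norm A)\<^sup>2 = (\<Sum>j<dim_col A. (l2_norm (col A j))\<^sup>2)"
proof -
  have "(frobenius_norm A)\<^sup>2 = (\<Sum>i<dim_row A. \<Sum>j<dim_col A. (A $$ (i, j))\<^sup>2)"
    by (simp add: frobenius_norm_def sum_nonneg)
  also have "\<dots> = (\<Sum>j<dim_col A. \<Sum>i<dim_row A. (A $$ (i, j))\<^sup>2)"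
    by (rule sum.swap)
  also have "\<dots> = (\<Sum>j<dim_col A. (l2_norm (col A j))\<^sup>2)"
    by (intro sum.cong refl) (simp add: l2_norm_def sum_nonneg)
  finally show ?thesis .
qed

lemma frobenius_norm_pos:
  assumes "A \<in> carrier_mat n k" "A \<noteq> 0\<^sub>m n k"
  shows "frobenius_norm A > 0"
proof -
  obtain i j where ij: "i < n" "j < k" "A $$ (i, j) \<noteq> 0"
    using assms by (auto simp: mat_eq_iff)
  have "(A $$ (i, j))\<^sup>2 \<le> (\<Sum>j<k. (A $$ (i, j))\<^sup>2)"
    by (rule member_le_sum) (use ij in auto)
  also have "\<dots> \<le> (\<Sum>i<n. \<Sum>j<k. (A $$ (i, j))\<^sup>2)"
    by (rule member_le_sum[where f = "\<lambda>i. \<Sum>j<k. (A $$ (i, j))\<^sup>2"])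
      (use ij in \<open>auto intro: sum_nonneg\<close>)
  finally have "(A $$ (i, j))\<^sup>2 \<le> (\<Sum>i<n. \<Sum>j<k. (A $$ (i, j))\<^sup>2)" .
  moreover have "0 < (A $$ (i, j))\<^sup>2" using ij(3) by simp
  ultimately have "0 < (\<Sum>i<n. \<Sum>j<k. (A $$ (i, j))\<^sup>2)" by linarith
  thus ?thesis using assms(1) by (simp add: frobenius_norm_def)
qed

lemma pmf_length_squared_pmf:
  assumes "A \<in> carrier_mat n k" "A \<noteq> 0\<^sub>m n k"
  shows "pmf (length_squared_pmf A) i =
    (if i < k then (l2_norm (col A i))\<^sup>2 / (frobenius_norm A)\<^sup>2 else 0)"
proof -
  let ?f = "\<lambda>i. if i < dim_col A then (l2_norm (col A i))\<^sup>2 / (frobenius_norm A)\<^sup>2 else 0"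
  have "(\<integral>\<^sup>+i. ennreal (?f i) \<partial>count_space UNIV) = (\<Sum>i<dim_col A. ennreal (?f i))"
    by (subst nn_integral_count_space'[of "{..<dim_col A}"]) auto
  also have "\<dots> = ennreal (\<Sum>i<dim_col A. ?f i)"
    by (rule sum_ennreal) auto
  also have "(\<Sum>i<dim_col A. ?f i) = (\<Sum>i<dim_col A. (l2_norm (col A i))\<^sup>2) / (frobenius_norm A)\<^sup>2"
    by (subst sum_divide_distrib, rule sum.cong) auto
  also have "\<dots> = 1"
    using frobenius_norm_pos[OF assms] by (simp flip: frobenius_norm_sq_eq_sum_cols)
  finally have "pmf (embed_pmf ?f) i = ?f i"
    by (intro pmf_embed_pmf) auto
  thus ?thesis using assms(1) by (simp add: length_squared_pmf_def)
qed

datatype action = Read nat nat | Output "nat list"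

text \<open>A deterministic algorithm chooses its next action from the list of all answers
  received so far, oldest first. (The positions queried so far are determined by these answers.)\<close>

type_synonym det_algorithm = "real list \<Rightarrow> action"

primrec answers :: "det_algorithm \<Rightarrow> real mat \<Rightarrow> nat \<Rightarrow> real list" where
  "answers t A 0 = []"
| "answers t A (Suc k) =
     (case t (answers t A k) of
        Read i j \<Rightarrow> answers t A k @ [A $$ (i, j)]
      | Output _ \<Rightarrow> answers t A k)"

definition action_at :: "det_algorithm \<Rightarrow> real mat \<Rightarrow> nat \<Rightarrow> action" where
  "action_at t A k = t (answers t A k)"

text \<open>Repeated queries to the same position count once.\<close>

definition entries_read :: "det_algorithm \<Rightarrow> real mat \<Rightarrow> (nat \<times> nat) set" where
  "entries_read t A = {(i, j). \<exists>k. action_at t A k = Read i j}"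

text \<open>\<open>None\<close> stands for a computation that never halts.\<close>

definition result :: "det_algorithm \<Rightarrow> real mat \<Rightarrow> nat list option" where
  "result t A =
     (if \<exists>k xs. action_at t A k = Output xs
      then Some (SOME xs. \<exists>k. action_at t A k = Output xs) else None)"

lemma action_at_Output_mono:
  assumes "action_at t A k = Output xs" "k \<le> l"
  shows "action_at t A l = Output xs"
  using assms(2,1) by (induction rule: dec_induct) (auto simp: action_at_def)

lemma result_eq_Some_iff: "result t A = Some xs \<longleftrightarrow> (\<exists>k. action_at t A k = Output xs)"
proof -
  have uniq: "xs = ys" if "action_at t A k = Output xs" "action_at t A l = Output ys" for xs ys k l
    using action_at_Output_mono[OF that(1), of "max k l"]
      action_at_Output_mono[OF that(2), of "max k l"] by simp
  show ?thesis
  proof (cases "\<exists>k ys. action_at t A k = Output ys")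
    case True
    then obtain k ys where ys: "action_at t A k = Output ys" by blast
    have "(SOME ys. \<exists>k. action_at t A k = Output ys) = ys"
      by (rule some_equality) (use ys uniq in blast)+
    hence "result t A = Some ys" using True by (simp add: result_def)
    thus ?thesis using ys uniq by (metis option.inject)
  next
    case False
    thus ?thesis by (auto simp: result_def)
  qed
qed

text \<open>A randomized algorithm is a probability distribution over deterministic ones. The
  \<open>\<sigma>\<close>-algebra is arbitrary, so this covers every source of randomness: an algorithm driven by a
  seed from any probability space is represented by the image measure under
  seed \<open>\<mapsto>\<close> algorithm. The last condition says that on every legal input each action of the
  algorithm is a random variable. Queries must be within bounds, as \<open>A $$ (i, j)\<close> is
  unspecified otherwise.\<close>

definition randomized_algorithm :: "nat \<Rightarrow> det_algorithm measure \<Rightarrow> bool" where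
  "randomized_algorithm n T \<longleftrightarrow>
     prob_space T \<and>
     (\<forall>t \<in> space T. \<forall>h i j. t h = Read i j \<longrightarrow> i < n \<and> j < n) \<and>
     (\<forall>A \<in> nonzero_psd n. \<forall>k. (\<lambda>t. action_at t A k) \<in> measurable T (count_space UNIV))"

definition length_squared_sampler :: "nat \<Rightarrow> nat \<Rightarrow> det_algorithm measure \<Rightarrow> bool" where
  "length_squared_sampler n m T \<longleftrightarrow>
     randomized_algorithm n T \<and>
     (\<forall>A \<in> nonzero_psd n.
        distr T (count_space UNIV) (\<lambda>t. result t A) =
        measure_pmf (map_pmf Some (replicate_pmf m (length_squared_pmf A))))"

definition expected_reads :: "det_algorithm measure \<Rightarrow> real mat \<Rightarrow> real" where
  "expected_reads T A = (\<integral>t. real (card (entries_read t A)) \<partial>T)"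

lemma finite_entries_read:
  assumes "randomized_algorithm n T" "t \<in> space T"
  shows "entries_read t A \<subseteq> {..<n} \<times> {..<n}" "finite (entries_read t A)"
proof -
  show "entries_read t A \<subseteq> {..<n} \<times> {..<n}"
    using assms by (auto simp: entries_read_def randomized_algorithm_def action_at_def)
  thus "finite (entries_read t A)" by (rule finite_subset) simp
qed

lemma measurable_result:
  assumes "randomized_algorithm n T" "A \<in> nonzero_psd n"
  shows "(\<lambda>t. result t A) \<in> measurable T (count_space UNIV)"
proof -
  have m [measurable]: "(\<lambda>t. action_at t A k) \<in> measurable T (count_space UNIV)" for k
    using assms by (simp add: randomized_algorithm_def)
  have S: "{t \<in> space T. result t A = Some xs} \<in> sets T" for xs
  proof -
    have "{t \<in> space T. \<exists>k. action_at t A k = Output xs} \<in> sets T" by measurable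
    thus ?thesis by (simp add: result_eq_Some_iff)
  qed
  have "{t \<in> space T. result t A = y} \<in> sets T" for y
  proof (cases y)
    case None
    have "{t \<in> space T. result t A = None} =
        space T - (\<Union>xs. {t \<in> space T. result t A = Some xs})" by auto
    also have "\<dots> \<in> sets T"
      using S by (intro sets.Diff sets.top sets.countable_UN) blast
    finally show ?thesis by (simp add: None)
  qed (use S in simp)
  thus ?thesis
    by (subst measurable_count_space_eq2_countable)
      (auto simp: vimage_def Int_def conj_commute)
qed

lemma integrable_card_entries_read:
  assumes "randomized_algorithm n T" "A \<in> nonzero_psd n"
  shows "integrable T (\<lambda>t. real (card (entries_read t A)))"
proof -
  interpret prob_space T using assms(1) by (simp add: randomized_algorithm_def)
  have m [measurable]: "(\<lambda>t. action_at t A k) \<in> measurable T (count_space UNIV)" for k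
    using assms by (simp add: randomized_algorithm_def)
  have eq: "real (card (entries_read t A)) =
      (\<Sum>p \<in> {..<n} \<times> {..<n}. if \<exists>k. action_at t A k = Read (fst p) (snd p) then 1 else 0)"
    if "t \<in> space T" for t
  proof -
    have "entries_read t A =
        {p \<in> {..<n} \<times> {..<n}. \<exists>k. action_at t A k = Read (fst p) (snd p)}"
      using finite_entries_read(1)[OF assms(1) that, of A] by (auto simp: entries_read_def)
    thus ?thesis by (simp add: sum.If_cases Int_def)
  qed
  show ?thesis
  proof (rule integrable_const_bound[where B = "real (card ({..<n} \<times> {..<n}))"])
    show "AE t in T. norm (real (card (entries_read t A))) \<le> real (card ({..<n} \<times> {..<n}))"
      using finite_entries_read(1)[OF assms(1)]
      by (intro AE_I2) (simp only: real_norm_def abs_of_nat of_nat_le_iff, rule card_mono, auto)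
    show "(\<lambda>t. real (card (entries_read t A))) \<in> borel_measurable T"
      by (subst measurable_cong[OF eq]) measurable
  qed
qed

end

theory Submission
  imports Defs
begin

text \<open>Compare the identity matrix \<open>I\<close> with \<open>A = I + E\<^sub>i\<^sub>j + E\<^sub>j\<^sub>i\<close>. Index \<open>i\<close> has probability \<open>1 / n\<close>
  under \<open>I\<close>, but \<open>2 / (n + 2)\<close> under \<open>A\<close>. With \<open>r = min m n\<close>, the probability that \<open>i\<close> occurs among
  the first \<open>r\<close> samples therefore differs by at least a constant times \<open>r / n\<close>. A run on \<open>I\<close> that
  reads neither \<open>(i, j)\<close> nor \<open>(j, i)\<close> is also a run on \<open>A\<close>, so on input \<open>I\<close> one of these two positions
  is read with probability at least that difference. Summing over all \<open>i \<noteq> j\<close> shows that already on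
  the identity matrix order of \<open>r n\<close> entries are read in expectation.\<close>

section \<open>Dependence of a run on the entries read\<close>

text \<open>By induction the histories coincide, so the next query on \<open>B\<close> is also one
  made on \<open>A\<close>. Hence agreement on the entries read on \<open>A\<close> is enough,
  without any knowledge of the run on \<open>B\<close>.\<close>

lemma answers_cong:
  assumes "\<And>i j. (i, j) \<in> entries_read t A \<Longrightarrow> B $$ (i, j) = A $$ (i, j)"
  shows "answers t B k = answers t A k"
proof (induction k)
  case (Suc k)
  have "B $$ (i, j) = A $$ (i, j)" if "t (answers t A k) = Read i j" for i j
    using that assms by (auto simp: entries_read_def action_at_def)
  thus ?case using Suc by (auto split: action.splits)
qed simp

lemma result_cong:
  assumes "\<And>i j. (i, j) \<in> entries_read t A \<Longrightarrow> B $$ (i, j) = A $$ (i, j)"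
  shows "result t B = result t A"
  using answers_cong[OF assms] by (simp add: result_def action_at_def)

section \<open>Prefixes of independent samples\<close>

text \<open>By independence each of the first \<open>min r m\<close> samples avoids \<open>i\<close>
  with probability \<open>1 - pmf p i\<close>. The prefix length varies in the induction because the
  first sample uses up one place.\<close>

lemma prob_notin_take_replicate_pmf:
  "measure_pmf.prob (replicate_pmf m p) {xs. i \<notin> set (take r xs)} = (1 - pmf p i) ^ min r m"
proof (induction m arbitrary: r)
  case (Suc m)
  show ?case
  proof (cases r)
    case (Suc s)
    have "measure_pmf.prob (replicate_pmf (Suc m) p) {xs. i \<notin> set (take r xs)} =
        measure_pmf.expectation p (\<lambda>x. measure_pmf.prob (replicate_pmf m p)
          {xs. i \<notin> set (take r (x # xs))})"
      by (simp add: measure_pmf_bind vimage_def flip: map_pmf_def)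
        (subst measure_pmf.measure_bind[where N = "count_space UNIV"], auto simp: vimage_def
          measure_pmf_in_subprob_algebra)
    also have "\<dots> = measure_pmf.expectation p
        (\<lambda>x. indicator (- {i}) x * (1 - pmf p i) ^ min s m)"
      using Suc Suc.IH[of s] by (intro Bochner_Integration.integral_cong) (auto simp: indicator_def)
    also have "\<dots> = (1 - pmf p i) * (1 - pmf p i) ^ min s m"
    proof -
      have "measure_pmf.prob p (UNIV - {i}) = 1 - pmf p i"
        using measure_pmf.prob_compl[of "{i}" p] by (simp add: measure_pmf_single)
      thus ?thesis by (simp add: Compl_eq_Diff_UNIV)
    qed
    finally show ?thesis using Suc by simp
  qed simp
qed simp

section \<open>The two inputs and their length-squared distributions\<close>

text \<open>Written with added indicators so that a sum along a row splits into three sums with at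
  most one nonzero term each.\<close>

definition pair_mat :: "nat \<Rightarrow> nat \<Rightarrow> nat \<Rightarrow> real mat" where
  "pair_mat n i j = mat n n (\<lambda>(a, b).
     (if a = b then 1 else 0) + (if a = i \<and> b = j then 1 else 0) + (if a = j \<and> b = i then 1 else 0))"

lemma index_pair_mat:
  assumes "a < n" "b < n"
  shows "pair_mat n i j $$ (a, b) =
    (if a = b then 1 else 0) + (if a = i \<and> b = j then 1 else 0) + (if a = j \<and> b = i then 1 else 0)"
  using assms by (simp add: pair_mat_def)

lemma pair_mat_carrier: "pair_mat n i j \<in> carrier_mat n n"
  by (simp add: pair_mat_def)

text \<open>The quadratic form is \<open>(x $ i + x $ j)\<^sup>2\<close> plus the squares of the
  other coordinates.\<close>

lemma pair_mat_nonzero_psd: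
  assumes "i < n" "j < n" "i \<noteq> j"
  shows "pair_mat n i j \<in> nonzero_psd n"
proof -
  let ?A = "pair_mat n i j"
  have "x \<bullet> (?A *\<^sub>v x) \<ge> 0" if x: "x \<in> carrier_vec n" for x
  proof -
    have Ax: "(?A *\<^sub>v x) $ a = x $ a + (if a = i then x $ j else 0) + (if a = j then x $ i else 0)"
      if "a < n" for a
    proof -
      have "(?A *\<^sub>v x) $ a = (\<Sum>b<n. (if a = b then x $ b else 0) +
          (if b = j then (if a = i then x $ b else 0) else 0) +
          (if b = i then (if a = j then x $ b else 0) else 0))"
        using x that by (auto simp: pair_mat_def scalar_prod_def lessThan_atLeast0 intro!: sum.cong)
      also have "\<dots> = x $ a + (if a = i then x $ j else 0) + (if a = j then x $ i else 0)"
        using assms that by (simp add: sum.distrib)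
      finally show ?thesis .
    qed
    have "x \<bullet> (?A *\<^sub>v x) = (\<Sum>a<n. x $ a * (?A *\<^sub>v x) $ a)"
      using carrier_matD(1)[OF pair_mat_carrier[of n i j]]
      by (simp add: scalar_prod_def lessThan_atLeast0 del: index_mult_mat_vec)
    also have "\<dots> = (\<Sum>a<n. (x $ a)\<^sup>2 +
        (if a = i then x $ a * x $ j else 0) + (if a = j then x $ a * x $ i else 0))"
      by (intro sum.cong)
        (auto simp: Ax power2_eq_square algebra_simps simp del: index_mult_mat_vec)
    also have "\<dots> = (\<Sum>a<n. (x $ a)\<^sup>2) + 2 * (x $ i * x $ j)"
      using assms by (simp add: sum.distrib)
    finally have eq: "x \<bullet> (?A *\<^sub>v x) = (\<Sum>a<n. (x $ a)\<^sup>2) + 2 * (x $ i * x $ j)" .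
    have "(x $ i)\<^sup>2 + (x $ j)\<^sup>2 = (\<Sum>a\<in>{i, j}. (x $ a)\<^sup>2)" using assms by simp
    also have "\<dots> \<le> (\<Sum>a<n. (x $ a)\<^sup>2)"
      by (rule sum_mono2) (use assms in auto)
    finally have "(x $ i + x $ j)\<^sup>2 \<le> x \<bullet> (?A *\<^sub>v x)"
      by (simp add: eq power2_sum)
    thus ?thesis using zero_le_power2 order_trans by blast
  qed
  moreover have "transpose_mat ?A = ?A"
    by (intro eq_matI) (simp_all add: pair_mat_def conj_commute eq_commute)
  moreover have "?A \<noteq> 0\<^sub>m n n"
  proof
    assume "?A = 0\<^sub>m n n"
    hence "?A $$ (i, i) = 0\<^sub>m n n $$ (i, i)" by simp
    thus False using assms by (simp add: index_pair_mat)
  qed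
  ultimately show ?thesis
    using pair_mat_carrier[of n i j] by (auto simp: nonzero_psd_def positive_semidefinite_def)
qed

lemma one_mat_nonzero_psd:
  assumes "n \<ge> 1"
  shows "1\<^sub>m n \<in> nonzero_psd n"
proof -
  have "x \<bullet> (1\<^sub>m n *\<^sub>v x) \<ge> 0" if "x \<in> carrier_vec n" for x :: "real vec"
    using that by (auto simp: scalar_prod_def intro!: sum_nonneg)
  moreover have "1\<^sub>m n \<noteq> (0\<^sub>m n n :: real mat)"
  proof
    assume "1\<^sub>m n = (0\<^sub>m n n :: real mat)"
    hence "1\<^sub>m n $$ (0, 0) = (0\<^sub>m n n :: real mat) $$ (0, 0)" by simp
    thus False using assms by simp
  qed
  ultimately show ?thesis
    by (auto simp: nonzero_psd_def positive_semidefinite_def)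
qed

text \<open>Columns \<open>i\<close> and \<open>j\<close> have squared norm 2 and the other
  \<open>n - 2\<close> columns have squared norm 1, so the squared Frobenius norm is
  \<open>n + 2\<close>.\<close>

lemma pmf_length_squared_pair_mat:
  assumes "i < n" "j < n" "i \<noteq> j"
  shows "pmf (length_squared_pmf (pair_mat n i j)) i = 2 / (real n + 2)"
proof -
  let ?A = "pair_mat n i j"
  have dim: "dim_row ?A = n" "dim_col ?A = n" by (simp_all add: pair_mat_def)
  have norm: "(l2_norm (col ?A b))\<^sup>2 = 1 + (if b = j then 1 else 0) + (if b = i then 1 else 0)"
    if "b < n" for b
  proof -
    have "(l2_norm (col ?A b))\<^sup>2 = (\<Sum>a<n. (?A $$ (a, b))\<^sup>2)"
      using that by (simp add: l2_norm_def dim sum_nonneg)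
    also have "\<dots> = (\<Sum>a<n. (if a = b then 1 else 0) + (if a = i then if b = j then 1 else 0 else 0)
        + (if a = j then if b = i then 1 else 0 else 0))"
    \<comment> \<open>As \<open>i \<noteq> j\<close>, at most one indicator is nonzero at each
      position, so every entry is 0 or 1 and equals its square.\<close>
    proof (intro sum.cong refl)
      fix a assume "a \<in> {..<n}"
      thus "(?A $$ (a, b))\<^sup>2 = (if a = b then 1 else 0) + (if a = i then if b = j then 1 else 0 else 0)
          + (if a = j then if b = i then 1 else 0 else 0)"
        using that assms(3) by (cases "a = b"; cases "a = i"; cases "a = j") (simp_all add: index_pair_mat)
    qed
    also have "\<dots> = 1 + (if b = j then 1 else 0) + (if b = i then 1 else 0)"
      using assms that by (simp add: sum.distrib)
    finally show ?thesis .
  qed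
  have "(frobenius_norm ?A)\<^sup>2 = (\<Sum>b<n. 1 + (if b = j then 1 else 0) + (if b = i then 1 else 0))"
    by (simp add: frobenius_norm_sq_eq_sum_cols dim norm)
  also have "\<dots> = real n + 2"
    using assms by (simp add: sum.distrib)
  finally show ?thesis
    using pair_mat_nonzero_psd[OF assms] assms norm[OF assms(1)]
    by (subst pmf_length_squared_pmf[of _ n n]) (simp_all add: nonzero_psd_def add.commute)
qed

lemma pmf_length_squared_one_mat:
  assumes "i < n"
  shows "pmf (length_squared_pmf (1\<^sub>m n)) i = 1 / real n"
proof -
  have norm: "(l2_norm (col (1\<^sub>m n) b))\<^sup>2 = 1" if "b < n" for b
  proof -
    have "(l2_norm (col (1\<^sub>m n) b))\<^sup>2 = (\<Sum>a<n. (1\<^sub>m n $$ (a, b))\<^sup>2)"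
      using that by (simp add: l2_norm_def sum_nonneg)
    also have "\<dots> = (\<Sum>a<n. if a = b then 1 else 0)"
      using that by (intro sum.cong) auto
    finally show ?thesis using that by simp
  qed
  have "(frobenius_norm (1\<^sub>m n))\<^sup>2 = real n"
    using norm by (simp add: frobenius_norm_sq_eq_sum_cols)
  thus ?thesis
    using one_mat_nonzero_psd[of n] assms norm[OF assms]
    by (subst pmf_length_squared_pmf[of _ n n]) (auto simp: nonzero_psd_def)
qed

section \<open>Occurrence of an index in the output\<close>

text \<open>Only a prefix is inspected: for \<open>m\<close> much larger than \<open>n\<close>, the
  full output would contain \<open>i\<close> with probability close to 1 on both inputs, and the
  event would not tell them apart. Runs that never halt lie outside the event.\<close>

definition outputs_in :: "nat \<Rightarrow> nat \<Rightarrow> nat list option set" where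
  "outputs_in r i = {y. \<exists>xs. y = Some xs \<and> i \<in> set (take r xs)}"

lemma prob_outputs_in:
  assumes "length_squared_sampler n m T" "A \<in> nonzero_psd n" "r \<le> m"
  shows "measure T {t \<in> space T. result t A \<in> outputs_in r i} =
    1 - (1 - pmf (length_squared_pmf A) i) ^ r"
proof -
  let ?p = "replicate_pmf m (length_squared_pmf A)"
  have meas: "(\<lambda>t. result t A) \<in> measurable T (count_space UNIV)"
    using assms by (intro measurable_result) (auto simp: length_squared_sampler_def)
  have "measure T {t \<in> space T. result t A \<in> outputs_in r i} =
      measure (distr T (count_space UNIV) (\<lambda>t. result t A)) (outputs_in r i)"
    using meas by (subst measure_distr) (auto simp: vimage_def Int_def conj_commute)
  also have "\<dots> = measure_pmf.prob (map_pmf Some ?p) (outputs_in r i)"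
    using assms by (simp add: length_squared_sampler_def)
  also have "\<dots> = measure_pmf.prob ?p (UNIV - {xs. i \<notin> set (take r xs)})"
    by (subst measure_map_pmf) (auto simp: outputs_in_def vimage_def intro!: arg_cong[of _ _ "measure _"])
  also have "\<dots> = 1 - (1 - pmf (length_squared_pmf A) i) ^ r"
    using assms(3) by (subst measure_pmf.prob_compl[of _ ?p, simplified])
      (simp add: prob_notin_take_replicate_pmf)
  finally show ?thesis .
qed

section \<open>The gap between the two probabilities\<close>

text \<open>With \<open>1 - 1 / n = b * (1 + x)\<close> the difference is
  \<open>b ^ r * ((1 + x) ^ r - 1)\<close>. The first factor is at least \<open>exp (-2)\<close>
  because \<open>r \<le> n\<close>, and Bernoulli's inequality bounds the second from below by
  \<open>r * x\<close>.\<close>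

lemma power_gap:
  fixes n r :: nat
  assumes "n \<ge> 4" "r \<le> n"
  shows "(1 - 1 / real n) ^ r - (1 - 2 / (real n + 2)) ^ r \<ge> exp (-2) * real r / (2 * real n)"
proof -
  define b where "b = 1 - 2 / (real n + 2)"
  define x where "x = 1 / real n - 2 / (real n)\<^sup>2"
  have n: "real n \<ge> 4" using assms by simp
  have b: "0 < b" "b \<le> 1" "b = 1 / (1 + 2 / real n)"
    using n by (auto simp: b_def field_simps)
  \<comment> \<open>For positive \<open>n\<close> this is equivalent to
    \<open>n \<ge> 4\<close>.\<close>
  have x: "x \<ge> 1 / (2 * real n)"
    using n by (simp add: x_def field_simps power2_eq_square)
  have "b = real n / (real n + 2)" "1 + x = (real n + 2) * (real n - 1) / (real n)\<^sup>2"
    using n by (simp_all add: b_def x_def field_simps power2_eq_square)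
  hence "b * (1 + x) = real n / (real n + 2) * ((real n + 2) * (real n - 1) / (real n)\<^sup>2)"
    by (simp only:)
  also have "\<dots> = (real n - 1) / real n"
    using n by (simp add: power2_eq_square)
  finally have ab: "1 - 1 / real n = b * (1 + x)"
    using n by (simp add: diff_divide_distrib)
  \<comment> \<open>This is \<open>1 + y \<le> exp y\<close> at \<open>y = 2 / n\<close>; the base
    \<open>1 + 2 / n\<close> is the inverse of \<open>b\<close>.\<close>
  have "(1 + 2 / real n) ^ n \<le> exp (2 / real n) ^ n"
    by (intro power_mono) auto
  also have "\<dots> = exp 2"
    using n by (subst exp_of_nat_mult[symmetric]) simp
  finally have "exp (-2) \<le> b ^ n"
    using n unfolding b(3) by (simp add: exp_minus power_divide field_simps)
  also have "\<dots> \<le> b ^ r"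
    using b assms by (intro power_decreasing) auto
  finally have br: "exp (-2) \<le> b ^ r" .
  have "x \<ge> -1" using x n by (smt (verit) divide_nonneg_nonneg)
  hence "1 + real r * x \<le> (1 + x) ^ r" by (rule Bernoulli_inequality)
  hence "real r * x \<le> (1 + x) ^ r - 1" by simp
  moreover have "real r * (1 / (2 * real n)) \<le> real r * x"
    using x by (intro mult_left_mono) auto
  ultimately have "real r / (2 * real n) \<le> (1 + x) ^ r - 1" by simp
  hence "exp (-2) * (real r / (2 * real n)) \<le> b ^ r * ((1 + x) ^ r - 1)"
    using br b by (intro mult_mono) auto
  thus ?thesis
    unfolding ab b_def[symmetric] power_mult_distrib by (simp add: right_diff_distrib)
qed

section \<open>Expected reads as a sum of probabilities\<close>

lemma measurable_entry_read:
  assumes "randomized_algorithm n T" "A \<in> nonzero_psd n"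
  shows "{t \<in> space T. p \<in> entries_read t A} \<in> sets T"
proof -
  have [measurable]: "(\<lambda>t. action_at t A k) \<in> measurable T (count_space UNIV)" for k
    using assms by (simp add: randomized_algorithm_def)
  have "{t \<in> space T. \<exists>k. action_at t A k = Read (fst p) (snd p)} \<in> sets T" by measurable
  thus ?thesis by (simp add: entries_read_def case_prod_beta)
qed

text \<open>Linearity of expectation for the indicators of the positions within bounds; no others
  are queried.\<close>

lemma expected_reads_eq_sum:
  assumes "randomized_algorithm n T" "A \<in> nonzero_psd n"
  shows "expected_reads T A =
    (\<Sum>i<n. \<Sum>j<n. measure T {t \<in> space T. (i, j) \<in> entries_read t A})"
proof -
  interpret prob_space T using assms(1) by (simp add: randomized_algorithm_def)
  have "expected_reads T A = (\<integral>t. (\<Sum>p\<in>{..<n} \<times> {..<n}.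
      indicator {t \<in> space T. p \<in> entries_read t A} t) \<partial>T)"
    unfolding expected_reads_def
  proof (rule Bochner_Integration.integral_cong[OF refl])
    fix t assume t: "t \<in> space T"
    have "(\<Sum>p\<in>{..<n} \<times> {..<n}. indicator {t \<in> space T. p \<in> entries_read t A} t) =
        (\<Sum>p\<in>{..<n} \<times> {..<n}. if p \<in> entries_read t A then 1 else (0::real))"
      using t by (intro sum.cong) auto
    also have "\<dots> = real (card (({..<n} \<times> {..<n}) \<inter> entries_read t A))"
      by (simp add: sum.If_cases)
    also have "({..<n} \<times> {..<n}) \<inter> entries_read t A = entries_read t A"
      using finite_entries_read(1)[OF assms(1) t] by blast
    finally show "real (card (entries_read t A)) = (\<Sum>p\<in>{..<n} \<times> {..<n}.
        indicator {t \<in> space T. p \<in> entries_read t A} t)" by simp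
  qed
  also have "\<dots> = (\<Sum>p\<in>{..<n} \<times> {..<n}. measure T {t \<in> space T. p \<in> entries_read t A})"
    using measurable_entry_read[OF assms]
    by (subst Bochner_Integration.integral_sum) (auto simp: emeasure_eq_measure)
  also have "\<dots> = (\<Sum>i<n. \<Sum>j<n. measure T {t \<in> space T. (i, j) \<in> entries_read t A})"
    by (simp add: sum.cartesian_product)
  finally show ?thesis .
qed

section \<open>Comparison of runs on the two inputs\<close>

text \<open>A coupling: the same deterministic \<open>t\<close> runs on both inputs. If
  \<open>i\<close> is in its output prefix on the perturbed matrix but not on the identity, the run
  on the identity has read a position where the two differ. The union bound then yields the claim,
  whose left-hand side is the difference of the two prefix probabilities.\<close>

lemma prob_read_pair_ge:
  assumes "length_squared_sampler n m T" "r \<le> m" "i < n" "j < n" "i \<noteq> j"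
  defines "q \<equiv> \<lambda>p. measure T {t \<in> space T. p \<in> entries_read t (1\<^sub>m n)}"
  shows "(1 - 1 / real n) ^ r - (1 - 2 / (real n + 2)) ^ r \<le> q (i, j) + q (j, i)"
proof -
  let ?I = "1\<^sub>m n :: real mat" and ?A = "pair_mat n i j"
  have ra: "randomized_algorithm n T" using assms(1) by (simp add: length_squared_sampler_def)
  interpret prob_space T using ra by (simp add: randomized_algorithm_def)
  have I: "?I \<in> nonzero_psd n" using assms(3) by (intro one_mat_nonzero_psd) simp
  have A: "?A \<in> nonzero_psd n" using assms(3-5) by (rule pair_mat_nonzero_psd)
  have meas: "{t \<in> space T. result t B \<in> Y} \<in> sets T" if "B \<in> nonzero_psd n" for B Y
    using measurable_sets[OF measurable_result[OF ra that], of Y]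
    by (simp add: vimage_def Int_def conj_commute)
  let ?O = "\<lambda>B. {t \<in> space T. result t B \<in> outputs_in r i}"
  let ?Q = "\<lambda>p. {t \<in> space T. p \<in> entries_read t ?I}"
  have Q: "?Q p \<in> sets T" for p using measurable_entry_read[OF ra I] .
  have "?O ?A \<subseteq> ?O ?I \<union> (?Q (i, j) \<union> ?Q (j, i))"
  proof
    fix t assume t: "t \<in> ?O ?A"
    show "t \<in> ?O ?I \<union> (?Q (i, j) \<union> ?Q (j, i))"
    proof (rule ccontr)
      assume neg: "t \<notin> ?O ?I \<union> (?Q (i, j) \<union> ?Q (j, i))"
      have "result t ?A = result t ?I"
      proof (rule result_cong)
        fix a b assume ab: "(a, b) \<in> entries_read t ?I"
        hence "a < n" "b < n" using finite_entries_read(1)[OF ra, of t ?I] t by auto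
        \<comment> \<open>In this form both extra indicators of \<open>pair_mat\<close> rewrite to
          0.\<close>
        moreover have "(a = i \<and> b = j) = False" "(a = j \<and> b = i) = False" using ab neg t by auto
        ultimately show "?A $$ (a, b) = ?I $$ (a, b)"
          by (simp only: index_pair_mat index_one_mat if_False add_0_right)
      qed
      thus False using t neg by simp
    qed
  qed
  hence "measure T (?O ?A) \<le> measure T (?O ?I \<union> (?Q (i, j) \<union> ?Q (j, i)))"
    using meas[OF I] Q by (intro finite_measure_mono) auto
  also have "\<dots> \<le> measure T (?O ?I) + (q (i, j) + q (j, i))"
    unfolding q_def using meas[OF I] Q
    by (intro order_trans[OF measure_Un_le] add_left_mono measure_Un_le) auto
  finally show ?thesis
    using assms(3-5) by (simp add: prob_outputs_in[OF assms(1) _ assms(2)] A I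
        pmf_length_squared_pair_mat pmf_length_squared_one_mat)
qed

section \<open>Summation over all pairs\<close>

theorem theorem5:
  shows "\<exists>(c::real) (n0::nat). c > 0 \<and> n0 \<ge> 1 \<and>
    (\<forall>(n::nat) (m::nat) (T :: det_algorithm measure).
       n \<ge> n0 \<longrightarrow> m \<ge> 1 \<longrightarrow> length_squared_sampler n m T \<longrightarrow>
       (\<exists>A \<in> nonzero_psd n.
          expected_reads T A \<ge> c * min (real m * real n) ((real n)\<^sup>2)))"
\<comment> \<open>The threshold 4 comes from \<open>power_gap\<close>. Each of the
  \<open>n * (n - 1)\<close> ordered pairs contributes \<open>exp (-2) * r / (2 * n)\<close>;
  halving for double counting and using \<open>n - 1 \<ge> n / 2\<close> leaves
  \<open>exp (-2) / 8 * r * n\<close>.\<close>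
proof (rule exI[of _ "exp (-2) / 8"], rule exI[of _ 4], intro conjI allI impI)
  fix n m :: nat and T :: "det_algorithm measure"
  assume n: "n \<ge> 4" and T: "length_squared_sampler n m T"
  define r where "r = min m n"
  define q where "q p = measure T {t \<in> space T. p \<in> entries_read t (1\<^sub>m n)}" for p
  define d where "d = exp (-2) * real r / (2 * real n)"
  have ra: "randomized_algorithm n T" using T by (simp add: length_squared_sampler_def)
  have I: "1\<^sub>m n \<in> nonzero_psd n" using n by (intro one_mat_nonzero_psd) simp
  have R: "expected_reads T (1\<^sub>m n) = (\<Sum>i<n. \<Sum>j<n. q (i, j))"
    using expected_reads_eq_sum[OF ra I] by (simp add: q_def)
  have d: "d \<le> q (i, j) + q (j, i)" if "i < n" "j < n" "i \<noteq> j" for i j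
    using power_gap[OF n, of r] prob_read_pair_ge[OF T _ that, of r]
    by (simp add: r_def d_def q_def)
  have "real n * (real n - 1) * d = (\<Sum>i<n. \<Sum>j\<in>{..<n} - {i}. d)"
    using n by (simp add: of_nat_diff)
  also have "\<dots> \<le> (\<Sum>i<n. \<Sum>j\<in>{..<n} - {i}. q (i, j) + q (j, i))"
    using d by (intro sum_mono) auto
  \<comment> \<open>Adding the nonnegative diagonal terms makes both summands run over all
    positions, so each yields the full expectation.\<close>
  also have "\<dots> \<le> (\<Sum>i<n. \<Sum>j<n. q (i, j) + q (j, i))"
    by (intro sum_mono sum_mono2) (auto simp: q_def)
  also have "\<dots> = 2 * expected_reads T (1\<^sub>m n)"
    using sum.swap[of "\<lambda>i j. q (j, i)" "{..<n}" "{..<n}"] by (simp add: sum.distrib R)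
  finally have 1: "real n * (real n - 1) * d \<le> 2 * expected_reads T (1\<^sub>m n)" .
  have "min (real m * real n) ((real n)\<^sup>2) = real r * real n"
    by (simp add: r_def of_nat_min min_mult_distrib_right power2_eq_square)
  hence "exp (-2) / 8 * min (real m * real n) ((real n)\<^sup>2) = exp (-2) / 4 * real r * (real n / 2)"
    by simp
  also have "\<dots> \<le> exp (-2) / 4 * real r * (real n - 1)"
    using n by (intro mult_left_mono) auto
  also have "\<dots> = real n * (real n - 1) * d / 2"
    using n by (simp add: d_def field_simps)
  finally show "\<exists>A\<in>nonzero_psd n.
      expected_reads T A \<ge> exp (-2) / 8 * min (real m * real n) ((real n)\<^sup>2)"
    using 1 I by (intro bexI[of _ "1\<^sub>m n"]) auto
qed auto

end
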